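(* Let $k$ be an odd positive integer, let $b$ be a real constant, and let $(\eta_n)_{n\ge-4k+1}$ be a well-defined real solution of $$\eta_{n+1}=\frac{\eta_{n-4k+1}}{-1+b\prod_{i=1}^{k}\eta_{n-4i+1}},\qquad n\ge 0,$$ with initial values $\eta_{-4k+1},\dots,\eta_0$. Then for all integers $n\ge0$ and all $j=0,1,\dots,4k-1$, $$\eta_{4kn-j}=\begin{cases}\eta_{-j}, & \text{if } n \text{ is even},\\[4pt] \eta_{-j}\left[-1+b\prod_{r=0}^{k-1}\eta_{-j+4\lfloor j/4\rfloor-4r}\right]^{(-1)^{\lfloor j/4\rfloor+1}}, & \text{if } n \text{ is odd}.\end{cases}$$ In particular $\eta_{8kn-j}=\eta_{-j}$ for all $n\ge 0$ and $j=0,1,\dots,4k-1$, and the solution is periodic with period $8k$.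
   Context: A solution is well-defined if every denominator $-1+b\prod_{i=1}^{k}\eta_{n-4i+1}$, $n\ge 0$, is non-zero. Periodic with period $8k$ means $\eta_{n+8k}=\eta_n$ for all $n\ge -4k+1$ (minimality of the period is not asserted). *)

theory Defs
  imports Complex_Main
begin

text \<open>
  A sequence with index set \<open>{-4k+1, -4k+2, ...}\<close> is a function on the integers
  of which only the values at indices \<open>\<ge> -4k+1\<close> are ever referred to.
\<close>

definition denom :: "nat \<Rightarrow> real \<Rightarrow> (int \<Rightarrow> real) \<Rightarrow> int \<Rightarrow> real" where
  "denom k b \<eta> n = - 1 + b * (\<Prod>i=1..k. \<eta> (n - 4 * int i + 1))"

definition well_defined_solution :: "nat \<Rightarrow> real \<Rightarrow> (int \<Rightarrow> real) \<Rightarrow> bool" where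
  "well_defined_solution k b \<eta> \<longleftrightarrow>
     (\<forall>n\<ge>0. denom k b \<eta> n \<noteq> 0 \<and> \<eta> (n + 1) = \<eta> (n - 4 * int k + 1) / denom k b \<eta> n)"

text \<open>Periodicity on the indices \<open>\<ge> n0\<close>; the period need not be minimal.\<close>

definition periodic_from :: "int \<Rightarrow> nat \<Rightarrow> (int \<Rightarrow> real) \<Rightarrow> bool" where
  "periodic_from n0 p \<eta> \<longleftrightarrow> (\<forall>n\<ge>n0. \<eta> (n + int p) = \<eta> n)"

end

theory Submission
  imports Defs
begin

text \<open>
  Write \<open>D m = - 1 + b * \<eta> m * \<eta> (m - 4) * ... * \<eta> (m - 4 (k - 1))\<close>. The denominator in the recurrence
  for \<open>\<eta> m\<close> is \<open>D (m - 4)\<close>, so \<open>\<eta> m * D (m - 4) = \<eta> (m - 4 k)\<close> for \<open>m \<ge> 1\<close>. Passing from \<open>m - 4\<close> to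
  \<open>m\<close> replaces the factor \<open>\<eta> (m - 4 k)\<close> of the product by \<open>\<eta> m\<close>, that is, divides the product by
  \<open>D (m - 4)\<close>. Writing \<open>P\<close> for the product, \<open>D m * D (m - 4) = - D (m - 4) + b * P (m - 4) = 1\<close>:
  the denominators along a residue class modulo 4 alternate between a number and its inverse
  (lemma \<open>block_denom_mult_previous\<close>).

  Hence \<open>\<eta> m = \<eta> (m - 4 k) * D m\<close> for \<open>m \<ge> 1\<close>, and \<open>D m\<close> equals \<open>D (- s)\<close> or its
  inverse, where \<open>0 \<le> s < 4\<close> and \<open>m + s\<close> is a multiple of 4, according to the parity of \<open>(m + s) / 4\<close>. A shift of the index by
  \<open>4 k\<close> changes this parity because \<open>k\<close> is odd, so the factors gained in two consecutive shifts by
  \<open>4 k\<close> cancel. This gives the period \<open>8 k\<close>, and the values after an odd number of shifts are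
  those after a single shift.
\<close>

text \<open>
  Indexing a denominator by the largest index in its product turns the alternation into a
  relation between neighbours in a residue class modulo 4.
\<close>

definition block_denom :: "nat \<Rightarrow> real \<Rightarrow> (int \<Rightarrow> real) \<Rightarrow> int \<Rightarrow> real" where
  "block_denom k b \<eta> m = - 1 + b * (\<Prod>r<k. \<eta> (m - 4 * int r))"

lemma denom_eq_block_denom: "denom k b \<eta> n = block_denom k b \<eta> (n - 3)"
proof -
  have "(\<Prod>i=1..k. \<eta> (n - 4 * int i + 1)) = (\<Prod>r<k. \<eta> (n - 3 - 4 * int r))"
    by (rule prod.reindex_bij_witness[of _ Suc "\<lambda>i. i - 1"]) (auto simp: algebra_simps of_nat_diff)
  then show ?thesis
    by (simp add: denom_def block_denom_def)
qed

lemma solution_recurrence: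
  assumes "well_defined_solution k b \<eta>" and "m \<ge> 1"
  shows "block_denom k b \<eta> (m - 4) \<noteq> 0"
    and "\<eta> m * block_denom k b \<eta> (m - 4) = \<eta> (m - 4 * int k)"
proof -
  have "denom k b \<eta> (m - 1) \<noteq> 0 \<and> \<eta> (m - 1 + 1) = \<eta> (m - 1 - 4 * int k + 1) / denom k b \<eta> (m - 1)"
    using assms unfolding well_defined_solution_def by (metis diff_ge_0_iff_ge)
  then show "block_denom k b \<eta> (m - 4) \<noteq> 0"
    and "\<eta> m * block_denom k b \<eta> (m - 4) = \<eta> (m - 4 * int k)"
    by (simp_all add: denom_eq_block_denom)
qed

text \<open>
  The two products share all factors but one. Comparing them by multiplication instead of
  division covers solutions that take the value 0.
\<close>

lemma block_denom_mult_previous: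
  assumes sol: "well_defined_solution k b \<eta>" and "k > 0" and m: "m \<ge> 1"
  shows "block_denom k b \<eta> m * block_denom k b \<eta> (m - 4) = 1"
proof -
  obtain l where k: "k = Suc l"
    using \<open>k > 0\<close> gr0_conv_Suc by blast
  define Q where "Q = (\<Prod>r<l. \<eta> (m - 4 - 4 * int r))"
  have cur: "block_denom k b \<eta> m = - 1 + b * (\<eta> m * Q)"
    by (simp add: block_denom_def k Q_def prod.lessThan_Suc_shift algebra_simps del: prod.lessThan_Suc)
  have prev: "block_denom k b \<eta> (m - 4) = - 1 + b * (Q * \<eta> (m - 4 * int k))"
    by (simp add: block_denom_def k Q_def algebra_simps)
  have "block_denom k b \<eta> m * block_denom k b \<eta> (m - 4)
      = - block_denom k b \<eta> (m - 4) + b * Q * (\<eta> m * block_denom k b \<eta> (m - 4))"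
    by (simp add: cur algebra_simps)
  also have "\<dots> = 1"
    unfolding solution_recurrence(2)[OF sol m] by (simp add: prev algebra_simps)
  finally show ?thesis .
qed

lemma solution_shift:
  assumes sol: "well_defined_solution k b \<eta>" and "k > 0" and "m \<ge> 1"
  shows "\<eta> m = \<eta> (m - 4 * int k) * block_denom k b \<eta> m"
proof -
  have "\<eta> (m - 4 * int k) * block_denom k b \<eta> m
      = \<eta> m * (block_denom k b \<eta> m * block_denom k b \<eta> (m - 4))"
    using solution_recurrence(2)[OF sol \<open>m \<ge> 1\<close>] by simp
  then show ?thesis
    by (simp add: block_denom_mult_previous[OF assms])
qed

lemma block_denom_alternates:
  assumes sol: "well_defined_solution k b \<eta>" and "k > 0" and m: "m \<ge> - 3"
  shows "block_denom k b \<eta> (m + 4 * int t)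
      = (if even t then block_denom k b \<eta> m else inverse (block_denom k b \<eta> m))"
proof (induction t)
  case 0
  show ?case by simp
next
  case (Suc t)
  have "block_denom k b \<eta> (m + 4 * int (Suc t)) * block_denom k b \<eta> (m + 4 * int t) = 1"
    using block_denom_mult_previous[OF sol \<open>k > 0\<close>, of "m + 4 * int (Suc t)"] m
    by (simp add: algebra_simps)
  then have "block_denom k b \<eta> (m + 4 * int (Suc t)) = inverse (block_denom k b \<eta> (m + 4 * int t))"
    by (metis inverse_unique mult.commute)
  then show ?case
    by (simp add: Suc.IH)
qed

text \<open>
  The two factors gained are \<open>D (m + 4 k)\<close> and \<open>D (m + 8 k)\<close>, which lie an odd number \<open>k\<close> of
  steps apart in their residue class modulo 4 and so are inverse to each other.
\<close>

lemma solution_period: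
  assumes sol: "well_defined_solution k b \<eta>" and "odd k" and m: "m \<ge> - 4 * int k + 1"
  shows "\<eta> (m + 8 * int k) = \<eta> m"
proof -
  have k: "k > 0"
    using \<open>odd k\<close> by (rule odd_pos)
  let ?D = "block_denom k b \<eta>"
  have "?D (m + 4 * int k) \<noteq> 0"
    using block_denom_mult_previous[OF sol k, of "m + 4 * int k"] m by auto
  moreover have "?D (m + 8 * int k) = inverse (?D (m + 4 * int k))"
    using block_denom_alternates[OF sol k, of "m + 4 * int k" k] m \<open>odd k\<close>
    by (simp add: algebra_simps)
  moreover have "\<eta> (m + 4 * int k) = \<eta> m * ?D (m + 4 * int k)"
    using solution_shift[OF sol k, of "m + 4 * int k"] m by simp
  moreover have "\<eta> (m + 8 * int k) = \<eta> (m + 4 * int k) * ?D (m + 8 * int k)"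
    using solution_shift[OF sol k, of "m + 8 * int k"] m by (simp add: add.commute)
  ultimately show ?thesis
    by simp
qed

lemma solution_multiple_period:
  assumes sol: "well_defined_solution k b \<eta>" and "odd k" and m: "m \<ge> - 4 * int k + 1"
  shows "\<eta> (m + 8 * int k * int n) = \<eta> m"
proof (induction n)
  case 0
  show ?case by simp
next
  case (Suc n)
  have "\<eta> (m + 8 * int k * int n + 8 * int k) = \<eta> (m + 8 * int k * int n)"
  proof (rule solution_period[OF sol \<open>odd k\<close>])
    have "0 \<le> 8 * int k * int n" by simp
    with m show "- 4 * int k + 1 \<le> m + 8 * int k * int n" by linarith
  qed
  then have "\<eta> (m + 8 * int k * int n + 8 * int k) = \<eta> m"
    by (simp only: Suc.IH)
  then show ?case
    by (simp add: algebra_simps)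
qed

text \<open>
  Write \<open>j = 4 q + s\<close> with \<open>s < 4\<close>. Then \<open>4 k - j\<close> lies \<open>k - q\<close> steps above \<open>- s\<close>, and \<open>k - q\<close> is even
  exactly when \<open>q + 1\<close> is, since \<open>k\<close> is odd.
\<close>

lemma solution_first_shift:
  assumes sol: "well_defined_solution k b \<eta>" and "odd k" and j: "j < 4 * k"
  shows "\<eta> (4 * int k - int j)
      = \<eta> (- int j) * block_denom k b \<eta> (- int j + 4 * int (j div 4)) powi ((- 1) ^ (j div 4 + 1))"
proof -
  have k: "k > 0"
    using \<open>odd k\<close> by (rule odd_pos)
  define q where "q = j div 4"
  have q: "q < k"
    using j by (auto simp: q_def)
  have low: "- int j + 4 * int q \<ge> - 3"
    unfolding q_def by linarith
  have idx: "4 * int k - int j = (- int j + 4 * int q) + 4 * int (k - q)"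
    using q by (simp add: of_nat_diff)
  have par: "even (k - q) \<longleftrightarrow> odd q"
    using q \<open>odd k\<close> by simp
  have "\<eta> (4 * int k - int j) = \<eta> (- int j) * block_denom k b \<eta> (4 * int k - int j)"
    using solution_shift[OF sol k, of "4 * int k - int j"] j by simp
  also have "block_denom k b \<eta> (4 * int k - int j)
      = block_denom k b \<eta> (- int j + 4 * int q) powi ((- 1) ^ (q + 1))"
    unfolding idx block_denom_alternates[OF sol k low] par
    by (cases "even q") (simp_all add: power_int_minus)
  finally show ?thesis
    by (simp add: q_def)
qed

theorem mainTheorem7:
  fixes k :: nat and b :: real and \<eta> :: "int \<Rightarrow> real"
  assumes "odd k"
    and "well_defined_solution k b \<eta>"
  shows "(\<forall>n::nat. \<forall>j\<in>{0..4 * k - 1}.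
            \<eta> (4 * int k * int n - int j) =
              (if even n then \<eta> (- int j)
               else \<eta> (- int j) *
                 (- 1 + b * (\<Prod>r=0..k - 1. \<eta> (- int j + 4 * int (j div 4) - 4 * int r)))
                   powi ((- 1) ^ (j div 4 + 1))))
       \<and> (\<forall>n::nat. \<forall>j\<in>{0..4 * k - 1}. \<eta> (8 * int k * int n - int j) = \<eta> (- int j))
       \<and> periodic_from (- 4 * int k + 1) (8 * k) \<eta>"
proof (intro conjI allI ballI)
  have k: "k > 0"
    using assms(1) by (rule odd_pos)
  have prod_eq: "(\<Prod>r=0..k - 1. \<eta> (m - 4 * int r)) = (\<Prod>r<k. \<eta> (m - 4 * int r))" for m
    using k by (intro prod.cong) auto
  fix n j :: nat
  assume "j \<in> {0..4 * k - 1}"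
  then have j: "j < 4 * k"
    using k by auto
  then show period: "\<eta> (8 * int k * int n - int j) = \<eta> (- int j)" for n
    using solution_multiple_period[OF assms(2,1), of "- int j" n] by simp
  show "\<eta> (4 * int k * int n - int j) =
          (if even n then \<eta> (- int j)
           else \<eta> (- int j) *
             (- 1 + b * (\<Prod>r=0..k - 1. \<eta> (- int j + 4 * int (j div 4) - 4 * int r)))
               powi ((- 1) ^ (j div 4 + 1)))"
  proof (cases "even n")
    case True
    then obtain i where "n = 2 * i" by blast
    then show ?thesis
      using period[of i] by (simp add: algebra_simps)
  next
    case False
    then obtain i where n: "n = 2 * i + 1" by (rule oddE)
    have "\<eta> (4 * int k * int n - int j) = \<eta> (4 * int k - int j)"
      using solution_multiple_period[OF assms(2,1), of "4 * int k - int j" i] j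
      by (simp add: n algebra_simps)
    then show ?thesis
      using False solution_first_shift[OF assms(2,1) j]
      by (simp only: prod_eq block_denom_def if_False)
  qed
next
  show "periodic_from (- 4 * int k + 1) (8 * k) \<eta>"
    unfolding periodic_from_def using solution_period[OF assms(2,1)] by simp
qed

end
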